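(* Let $\Omega=\langle S,A,T,R,b_0,\gamma\rangle$ be a target task (an episodic MDP with at most $H$ steps per episode), let $L=\{\pi_1,\dots,\pi_n\}$ be a library of source policies, and let $\psi_h\in[0,1]$, $1\le h\le H$, be reuse probabilities. Suppose source policies are selected from $L$ sequentially by UCB1 according to the reward of each episode of $\pi$-reuse, i.e. the reward obtained from selecting $\pi_j$ is the discounted reward of one $\pi$-reuse episode executed with $\pi_j$ (as defined in the context). Then the expected regret is logarithmically bounded: writing $\mu_j$ for the expected discounted reward of a $\pi$-reuse episode with $\pi_j$, $\mu^*=\max_{1\le j\le n}\mu_j$, and $j(i)$ for the index of the $i$-th source policy selected, $$m\,\mu^*-\mathbb{E}\Big[\sum_{i=1}^{m}\mu_{j(i)}\Big]=O(\ln m)$$ as the number $m$ of selections grows.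
   Context: MDP: $S$ is a discrete state space, $A$ a discrete action space, $T(s,a,s')$ the transition function, $R(s,a,s')$ the reward function, $b_0$ the distribution of the start state, and $\gamma$ the discount factor. An episode starts in a state sampled from $b_0$ and ends upon reaching a final (absorbing) state or after $H$ steps. Each source policy $\pi_j:S\to A$ is the optimal policy of some source task $\Omega_j$ in the same domain. $\pi$-reuse episode with source policy $\pi_j$: choose the initial state $s$ randomly (according to $b_0$). At each step $h=1,\dots,H$, with probability $\psi_h$ take the action $a=\pi_j(s)$, and with probability $1-\psi_h$ take a random action (given by a random policy). Observe the next state $s'$ and the reward $r_h$, then set $s\leftarrow s'$. A table $Q(s,a)$ is also updated by the Q-learning rule during the episode, but it does not influence the choice of actions (no greedy actions are taken). The reward of the episode is $\sum_{h=1}^{H}\gamma^h r_h$. UCB1 over the library: first, each $\pi_j$ is selected once. Afterwards, at each selection, choose $$j\in\arg\max_{1\le j\le n}\left(W_j+\sqrt{\frac{2\ln\big(\sum_{i=1}^n T_i\big)}{T_j}}\right),$$ where $T_j$ is the number of times $\pi_j$ has been selected so far and $W_j$ is the empirical average of the episode rewards obtained in those selections. The regret is the sum over the selections of the difference between $\mu^*$ and the expected reward of the selected policy.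
   Formalization: The discounted rewards of all π-reuse episodes are assumed to lie in one common interval of length 1 (the standard UCB1 normalization); for rewards of larger range the claim fails, e.g. a policy yielding 0 or 10 with equal probability against one yielding 4 surely. *)

theory Defs
  imports "HOL-Probability.Probability" "HOL-Library.Landau_Symbols"
begin

text \<open>
  The state and action spaces are the types \<open>'s\<close> and \<open>'a\<close>, and the probability \<open>T(s, a, s')\<close> is
  \<open>pmf (transition \<Omega> s a) s'\<close>.  An episode stops as soon as it is in a state of \<open>final \<Omega>\<close>, so the
  values of \<open>transition \<Omega>\<close> and \<open>reward \<Omega>\<close> at final states are immaterial; this lets tasks with
  different final states share one transition function.
\<close>

record ('s, 'a) task =
  transition :: "'s \<Rightarrow> 'a \<Rightarrow> 's pmf"
  reward :: "'s \<Rightarrow> 'a \<Rightarrow> 's \<Rightarrow> real"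
  start :: "'s pmf"
  discount :: real
  final :: "'s set"
  horizon :: nat

definition wf_task :: "('s, 'a) task \<Rightarrow> bool" where
  "wf_task \<Omega> \<longleftrightarrow> 0 \<le> discount \<Omega> \<and> discount \<Omega> \<le> 1"

text \<open>
  \<open>rollout \<Omega> act k h s\<close> is the joint law of the rewards \<open>r\<^sub>h, r\<^sub>h\<^sub>+\<^sub>1, \<dots>\<close> observed from step \<open>h\<close> on,
  when step \<open>h\<close> starts in state \<open>s\<close>, at most \<open>k\<close> steps remain, and the action taken in state \<open>x\<close>
  at step \<open>i\<close> is drawn from \<open>act i x\<close>.
\<close>

primrec rollout ::
  "('s, 'a) task \<Rightarrow> (nat \<Rightarrow> 's \<Rightarrow> 'a pmf) \<Rightarrow> nat \<Rightarrow> nat \<Rightarrow> 's \<Rightarrow> real list pmf" where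
  "rollout \<Omega> act 0 h s = return_pmf []"
| "rollout \<Omega> act (Suc k) h s =
     (if s \<in> final \<Omega> then return_pmf []
      else do {
        a \<leftarrow> act h s;
        s' \<leftarrow> transition \<Omega> s a;
        rs \<leftarrow> rollout \<Omega> act k (Suc h) s';
        return_pmf (reward \<Omega> s a s' # rs)
      })"

text \<open>The list index starts at 0, the step number at 1.\<close>

definition discounted_sum :: "real \<Rightarrow> real list \<Rightarrow> real" where
  "discounted_sum \<gamma> rs = (\<Sum>h = 1..length rs. \<gamma> ^ h * rs ! (h - 1))"

definition episode_reward :: "('s, 'a) task \<Rightarrow> (nat \<Rightarrow> 's \<Rightarrow> 'a pmf) \<Rightarrow> real pmf" where
  "episode_reward \<Omega> act = do {
     s \<leftarrow> start \<Omega>;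
     rs \<leftarrow> rollout \<Omega> act (horizon \<Omega>) 1 s;
     return_pmf (discounted_sum (discount \<Omega>) rs)
   }"

definition reuse_action ::
  "(nat \<Rightarrow> real) \<Rightarrow> ('s \<Rightarrow> 'a pmf) \<Rightarrow> ('s \<Rightarrow> 'a) \<Rightarrow> nat \<Rightarrow> 's \<Rightarrow> 'a pmf" where
  "reuse_action \<psi> \<rho> \<pi> h s = do {
     reuse \<leftarrow> bernoulli_pmf (\<psi> h);
     if reuse then return_pmf (\<pi> s) else \<rho> s
   }"

text \<open>
  The law of the discounted reward of one \<open>\<pi>\<close>-reuse episode with reuse probabilities \<open>\<psi>\<close> and
  random policy \<open>\<rho>\<close>.  The Q-table is not represented: it is updated from the observed transitions,
  but neither the actions nor the rewards depend on it.
\<close>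

definition reuse_reward ::
  "('s, 'a) task \<Rightarrow> (nat \<Rightarrow> real) \<Rightarrow> ('s \<Rightarrow> 'a pmf) \<Rightarrow> ('s \<Rightarrow> 'a) \<Rightarrow> real pmf" where
  "reuse_reward \<Omega> \<psi> \<rho> \<pi> = episode_reward \<Omega> (reuse_action \<psi> \<rho> \<pi>)"

definition mean :: "real pmf \<Rightarrow> real" where
  "mean p = measure_pmf.expectation p (\<lambda>x. x)"

definition policy_reward :: "('s, 'a) task \<Rightarrow> ('s \<Rightarrow> 'a) \<Rightarrow> real pmf" where
  "policy_reward \<Omega> \<pi> = episode_reward \<Omega> (\<lambda>h s. return_pmf (\<pi> s))"

text \<open>Integrability is required because the Bochner integral of a non-integrable function is 0.\<close>

definition optimal_policy :: "('s, 'a) task \<Rightarrow> ('s \<Rightarrow> 'a) \<Rightarrow> bool" where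
  "optimal_policy \<Omega> \<pi> \<longleftrightarrow>
     (\<forall>\<pi>'. integrable (measure_pmf (policy_reward \<Omega> \<pi>')) (\<lambda>x. x)) \<and>
     (\<forall>\<pi>'. mean (policy_reward \<Omega> \<pi>') \<le> mean (policy_reward \<Omega> \<pi>))"

definition source_policy :: "('s, 'a) task \<Rightarrow> ('s \<Rightarrow> 'a) \<Rightarrow> bool" where
  "source_policy \<Omega> \<pi> \<longleftrightarrow>
     (\<exists>\<Omega>' :: ('s, 'a) task. wf_task \<Omega>' \<and> transition \<Omega>' = transition \<Omega> \<and> optimal_policy \<Omega>' \<pi>)"

text \<open>A history lists the selections made so far, each with the reward it yielded, oldest first.\<close>

type_synonym history = "(nat \<times> real) list"

definition selections :: "history \<Rightarrow> nat \<Rightarrow> nat" where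
  "selections hist j = length (filter (\<lambda>(i, r). i = j) hist)"

definition average_reward :: "history \<Rightarrow> nat \<Rightarrow> real" where
  "average_reward hist j =
     (\<Sum>(i, r)\<leftarrow>filter (\<lambda>(i, r). i = j) hist. r) / real (selections hist j)"

definition ucb1_index :: "nat \<Rightarrow> history \<Rightarrow> nat \<Rightarrow> real" where
  "ucb1_index n hist j =
     average_reward hist j +
     sqrt (2 * ln (real (\<Sum>i = 1..n. selections hist i)) / real (selections hist j))"

definition ucb1_choices :: "nat \<Rightarrow> history \<Rightarrow> nat set" where
  "ucb1_choices n hist =
     (if \<exists>j\<in>{1..n}. selections hist j = 0
      then {j \<in> {1..n}. selections hist j = 0}
      else {j \<in> {1..n}. \<forall>i\<in>{1..n}. ucb1_index n hist i \<le> ucb1_index n hist j})"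

text \<open>
  The order of the initial selections and the resolution of ties are left open, and may depend on
  the history and on chance.
\<close>

definition ucb1_rule :: "nat \<Rightarrow> (history \<Rightarrow> nat pmf) \<Rightarrow> bool" where
  "ucb1_rule n select \<longleftrightarrow> (\<forall>hist. set_pmf (select hist) \<subseteq> ucb1_choices n hist)"

text \<open>
  \<open>run select X m\<close> is the law of the history after \<open>m\<close> selections, where selecting \<open>j\<close> yields a
  fresh sample of \<open>X j\<close>.
\<close>

primrec run :: "(history \<Rightarrow> nat pmf) \<Rightarrow> (nat \<Rightarrow> real pmf) \<Rightarrow> nat \<Rightarrow> history pmf" where
  "run select X 0 = return_pmf []"
| "run select X (Suc m) = do {
     hist \<leftarrow> run select X m;
     j \<leftarrow> select hist;
     r \<leftarrow> X j;
     return_pmf (hist @ [(j, r)])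
   }"

definition expected_regret ::
  "nat \<Rightarrow> (history \<Rightarrow> nat pmf) \<Rightarrow> (nat \<Rightarrow> real pmf) \<Rightarrow> nat \<Rightarrow> real" where
  "expected_regret n select X m =
     real m * Max ((\<lambda>j. mean (X j)) ` {1..n}) -
     measure_pmf.expectation (run select X m) (\<lambda>hist. \<Sum>(j, r)\<leftarrow>hist. mean (X j))"

end

theory Submission
  imports Defs "HOL-Probability.Hoeffding"
begin

text \<open>
  By Hoeffding's lemma for rewards in \<open>{c..c + 1}\<close>, \<open>exp (l S - l\<^sup>2 N / 8)\<close> is a supermartingale, where
  \<open>N\<close> counts the selections of an arm and \<open>S\<close> is the centred sum of the rewards it yielded.
  A union bound over the \<open>m\<close> possible values of \<open>N\<close> and both signs of \<open>S\<close> then shows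
  that after \<open>m\<close> selections an average is off by more than its confidence width with probability at
  most \<open>2 / m\<^sup>3\<close>, which is summable.  As long as neither the average of an optimal arm nor that of
  \<open>j\<close> is off, \<open>j\<close> is not selected any more once \<open>N > L = 8 ln m / \<Delta>\<^sup>2\<close>; hence \<open>max N (L + 1)\<close> grows only
  at selections where one of them is off, and its expectation is at most \<open>L\<close> plus a constant.
\<close>

section \<open>Selection counts and centred reward sums\<close>

definition deviation :: "(nat \<Rightarrow> real pmf) \<Rightarrow> history \<Rightarrow> nat \<Rightarrow> real" where
  "deviation X hist k = (\<Sum>(i, r)\<leftarrow>filter (\<lambda>(i, r). i = k) hist. r - mean (X k))"

text \<open>The event that the average of arm \<open>k\<close> misses its mean by at least the UCB1
  width, with both sides multiplied by the count. At count 0 both sides of the inequality vanish, so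
  that case is excluded explicitly.\<close>

definition deviates :: "(nat \<Rightarrow> real pmf) \<Rightarrow> nat \<Rightarrow> history set" where
  "deviates X k = {hist. 1 \<le> selections hist k \<and>
     sqrt (2 * ln (real (length hist)) * real (selections hist k)) \<le> \<bar>deviation X hist k\<bar>}"

lemma selections_Nil [simp]: "selections [] k = 0"
  by (simp add: selections_def)

lemma selections_snoc [simp]:
  "selections (hist @ [(j, r)]) k = selections hist k + (if j = k then 1 else 0)"
  by (simp add: selections_def)

lemma deviation_Nil [simp]: "deviation X [] k = 0"
  by (simp add: deviation_def)

lemma deviation_snoc [simp]:
  "deviation X (hist @ [(j, r)]) k = deviation X hist k + (if j = k then r - mean (X k) else 0)"
  by (simp add: deviation_def)

lemma selections_le_length: "selections hist k \<le> length hist"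
  by (simp add: selections_def)

lemma sum_list_selections:
  fixes f :: "nat \<Rightarrow> real"
  assumes "fst ` set hist \<subseteq> A" "finite A"
  shows "(\<Sum>(j, r)\<leftarrow>hist. f j) = (\<Sum>j\<in>A. f j * real (selections hist j))"
  using assms(1)
proof (induction hist rule: rev_induct)
  case (snoc x hist)
  obtain j r where x: "x = (j, r)" by force
  have "(\<Sum>i\<in>A. f i * real (if j = i then 1 else 0)) = f j"
    using snoc.prems assms(2) x by (simp add: if_distrib[of real] if_distrib[of "(*) _"] cong: if_cong)
  then show ?case
    using snoc x by (simp add: distrib_left sum.distrib)
qed simp

text \<open>Identifies the total count under the logarithm in \<open>ucb1_index\<close> with the
  length of the history, which is the quantity used in \<open>deviates\<close>.\<close>

lemma length_eq_sum_selections: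
  assumes "fst ` set hist \<subseteq> A" "finite A"
  shows "length hist = (\<Sum>j\<in>A. selections hist j)"
proof -
  have "(\<Sum>(j, r)\<leftarrow>hist. 1 :: real) = real (length hist)"
    by (induction hist) auto
  then have "real (length hist) = real (\<Sum>j\<in>A. selections hist j)"
    using sum_list_selections[OF assms, of "\<lambda>_. 1"] by simp
  then show ?thesis by linarith
qed

lemma average_reward_eq:
  assumes "selections hist k \<noteq> 0"
  shows "average_reward hist k = mean (X k) + deviation X hist k / real (selections hist k)"
proof -
  have "(\<Sum>(i, r)\<leftarrow>filter (\<lambda>(i, r). i = k) hist. r) =
      real (selections hist k) * mean (X k) + deviation X hist k"
    by (induction hist rule: rev_induct)
      (auto simp: selections_def deviation_def algebra_simps)
  with assms show ?thesis
    by (simp add: average_reward_def add_divide_distrib)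
qed

lemma length_run: "hist \<in> set_pmf (run select X m) \<Longrightarrow> length hist = m"
  by (induction m arbitrary: hist) auto

lemma run_arms:
  assumes "ucb1_rule n select" "hist \<in> set_pmf (run select X m)"
  shows "fst ` set hist \<subseteq> {1..n}"
  using assms(2)
proof (induction m arbitrary: hist)
  case (Suc m)
  then obtain h j r where h: "h \<in> set_pmf (run select X m)" "j \<in> set_pmf (select h)"
    "hist = h @ [(j, r)]" by auto
  have "j \<in> ucb1_choices n h"
    using assms(1) h(2) by (auto simp: ucb1_rule_def)
  then have "j \<in> {1..n}"
    by (auto simp: ucb1_choices_def split: if_splits)
  with Suc.IH[OF h(1)] h(3) show ?case by auto
qed simp

section \<open>Exponential moments and tail bounds\<close>

lemma Hoeffdings_lemma_pmf:
  fixes p :: "real pmf"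
  assumes "set_pmf p \<subseteq> {c..c + 1}" "0 < l" "\<sigma> = 1 \<or> \<sigma> = - 1"
  shows "(\<integral>\<^sup>+r. ennreal (exp (l * \<sigma> * (r - mean p))) \<partial>p) \<le> ennreal (exp (l\<^sup>2 / 8))"
proof -
  \<comment> \<open>The sign \<open>\<sigma>\<close> treats both tails at once; for
    \<open>\<sigma> = - 1\<close> the interval is reflected to \<open>{- c - 1..- c}\<close>, again
    of length 1.\<close>
  have *: "interval_bounded_random_variable (measure_pmf p) (\<lambda>r. \<sigma> * r)
      (if \<sigma> = 1 then c else - c - 1) (if \<sigma> = 1 then c + 1 else - c)"
    using assms by unfold_locales (auto simp: AE_measure_pmf_iff subset_iff)
  have "(\<integral>\<^sup>+r. ennreal (exp (l * (\<sigma> * r - measure_pmf.expectation p (\<lambda>r. \<sigma> * r)))) \<partial>p)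
      \<le> ennreal (exp (l\<^sup>2 * ((if \<sigma> = 1 then c + 1 else - c) - (if \<sigma> = 1 then c else - c - 1))\<^sup>2 / 8))"
    by (rule interval_bounded_random_variable.Hoeffdings_lemma_nn_integral[OF * \<open>0 < l\<close>])
  moreover have "l * (\<sigma> * r - measure_pmf.expectation p (\<lambda>r. \<sigma> * r)) = l * \<sigma> * (r - mean p)" for r
    by (simp add: mean_def algebra_simps)
  ultimately show ?thesis
    by (simp only:) (simp split: if_splits)
qed

text \<open>
  The integrand is a supermartingale for every selection rule, so no independence between the number
  of selections of an arm and the rewards it yielded is needed.
\<close>

lemma nn_integral_exp_deviation:
  assumes X: "set_pmf (X k) \<subseteq> {c..c + 1}" and "0 < l" "\<sigma> = 1 \<or> \<sigma> = - 1"
  shows "(\<integral>\<^sup>+hist. ennreal (exp (l * \<sigma> * deviation X hist k - l\<^sup>2 / 8 * real (selections hist k)))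
           \<partial>run select X m) \<le> 1"
proof (induction m)
  case (Suc m)
  let ?M = "\<lambda>hist. ennreal (exp (l * \<sigma> * deviation X hist k - l\<^sup>2 / 8 * real (selections hist k)))"
  \<comment> \<open>Only a selection of \<open>k\<close> changes the integrand, and then the
    compensator \<open>exp (- (l\<^sup>2 / 8))\<close> cancels the bound from Hoeffding's
    lemma.\<close>
  have step: "(\<integral>\<^sup>+r. ?M (hist @ [(j, r)]) \<partial>X j) \<le> ?M hist" for hist j
  proof (cases "j = k")
    case True
    have "?M (hist @ [(k, r)]) =
        ?M hist * ennreal (exp (- (l\<^sup>2 / 8))) * ennreal (exp (l * \<sigma> * (r - mean (X k))))" for r
      by (simp add: algebra_simps flip: ennreal_mult' exp_add)
    then have "(\<integral>\<^sup>+r. ?M (hist @ [(j, r)]) \<partial>X j) =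
        ?M hist * ennreal (exp (- (l\<^sup>2 / 8))) * (\<integral>\<^sup>+r. ennreal (exp (l * \<sigma> * (r - mean (X k)))) \<partial>X k)"
      unfolding True by (simp add: nn_integral_cmult)
    also have "\<dots> \<le> ?M hist * ennreal (exp (- (l\<^sup>2 / 8))) * ennreal (exp (l\<^sup>2 / 8))"
      by (intro mult_left_mono Hoeffdings_lemma_pmf[OF X assms(2,3)]) simp
    also have "\<dots> = ?M hist"
      by (simp add: mult.assoc flip: ennreal_mult' exp_add)
    finally show ?thesis .
  qed simp
  have "(\<integral>\<^sup>+hist. ?M hist \<partial>run select X (Suc m)) =
      (\<integral>\<^sup>+hist. \<integral>\<^sup>+j. \<integral>\<^sup>+r. ?M (hist @ [(j, r)]) \<partial>X j \<partial>select hist \<partial>run select X m)"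
    by simp
  also have "\<dots> \<le> (\<integral>\<^sup>+hist. \<integral>\<^sup>+j. ?M hist \<partial>select hist \<partial>run select X m)"
    by (intro nn_integral_mono step)
  also have "\<dots> \<le> 1"
    using Suc by simp
  finally show ?case .
qed simp

text \<open>Chernoff's method: on the event the count is the fixed number \<open>s\<close>, so the
  supermartingale is at least \<open>exp (2 * a\<^sup>2 / real s)\<close> there, while its
  expectation is at most 1.\<close>

lemma prob_deviation_ge:
  assumes X: "set_pmf (X k) \<subseteq> {c..c + 1}" and "0 < a" "1 \<le> s" "\<sigma> = 1 \<or> \<sigma> = - 1"
  shows "measure_pmf.prob (run select X m) {hist. selections hist k = s \<and> a \<le> \<sigma> * deviation X hist k}
           \<le> exp (- 2 * a\<^sup>2 / real s)" (is "measure_pmf.prob _ ?A \<le> _")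
proof -
  \<comment> \<open>This \<open>l\<close> maximises the exponent
    \<open>l * a - l\<^sup>2 / 8 * real s\<close>.\<close>
  define l where "l = 4 * a / real s"
  have l: "0 < l" using assms by (simp add: l_def)
  have "ennreal (exp (2 * a\<^sup>2 / real s)) * emeasure (run select X m) ?A =
      (\<integral>\<^sup>+hist. ennreal (exp (2 * a\<^sup>2 / real s)) * indicator ?A hist \<partial>run select X m)"
    by (rule nn_integral_cmult_indicator[symmetric]) simp
  also have "\<dots> \<le> (\<integral>\<^sup>+hist. ennreal (exp (l * \<sigma> * deviation X hist k - l\<^sup>2 / 8 * real (selections hist k)))
      \<partial>run select X m)"
  proof (rule nn_integral_mono)
    fix hist
    have "2 * a\<^sup>2 / real s \<le> l * \<sigma> * deviation X hist k - l\<^sup>2 / 8 * real s"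
      if "a \<le> \<sigma> * deviation X hist k"
    proof -
      have "l * a \<le> l * (\<sigma> * deviation X hist k)"
        using l that by simp
      moreover have "l * a - l\<^sup>2 / 8 * real s = 2 * a\<^sup>2 / real s"
        using assms by (simp add: l_def field_simps power2_eq_square)
      ultimately show ?thesis by (simp add: mult.assoc)
    qed
    then show "ennreal (exp (2 * a\<^sup>2 / real s)) * indicator ?A hist \<le>
        ennreal (exp (l * \<sigma> * deviation X hist k - l\<^sup>2 / 8 * real (selections hist k)))"
      by (auto simp: indicator_def intro!: ennreal_leI)
  qed
  also have "\<dots> \<le> 1"
    using X l assms(4) by (rule nn_integral_exp_deviation)
  finally have "exp (2 * a\<^sup>2 / real s) * measure_pmf.prob (run select X m) ?A \<le> 1"
    by (simp add: measure_pmf.emeasure_eq_measure flip: ennreal_mult')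
  then show ?thesis
    by (simp add: exp_minus field_simps)
qed

text \<open>For one count \<open>s\<close> and one sign the exponent is -4 ln m, which gives m^-4;
  there are m counts and two signs.\<close>

lemma prob_deviates:
  assumes X: "set_pmf (X k) \<subseteq> {c..c + 1}" and "2 \<le> m"
  shows "measure_pmf.prob (run select X m) (deviates X k) \<le> 2 * inverse (real m ^ 3)"
proof -
  let ?P = "measure_pmf.prob (run select X m)"
  define a where "a = (\<lambda>s. sqrt (2 * ln (real m) * real s))"
  define B where "B = (\<lambda>\<sigma> s. {hist. selections hist k = s \<and> a s \<le> \<sigma> * deviation X hist k})"
  have PB: "?P (B \<sigma> s) \<le> inverse (real m ^ 4)" if "1 \<le> s" "\<sigma> = 1 \<or> \<sigma> = - 1" for \<sigma> s
  proof -
    have "?P (B \<sigma> s) \<le> exp (- 2 * (a s)\<^sup>2 / real s)"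
      unfolding B_def using assms that by (intro prob_deviation_ge) (auto simp: a_def)
    also have "(a s)\<^sup>2 = 2 * ln (real m) * real s"
      using assms(2) by (simp add: a_def)
    also have "exp (- 2 * (2 * ln (real m) * real s) / real s) = exp (- (of_nat 4 * ln (real m)))"
      using that by simp
    also have "\<dots> = inverse (real m ^ 4)"
      unfolding exp_minus exp_of_nat_mult using assms(2) by simp
    finally show ?thesis .
  qed
  \<comment> \<open>On the support the history has length \<open>m\<close>, which bounds the count
    by \<open>m\<close> and makes the union finite.\<close>
  have "?P (deviates X k) = ?P (deviates X k \<inter> set_pmf (run select X m))"
    by (simp add: measure_Int_set_pmf)
  also have "\<dots> \<le> ?P (\<Union>s\<in>{1..m}. B 1 s \<union> B (- 1) s)"
  proof (rule measure_pmf.finite_measure_mono)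
    show "deviates X k \<inter> set_pmf (run select X m) \<subseteq> (\<Union>s\<in>{1..m}. B 1 s \<union> B (- 1) s)"
    proof
      fix hist assume h: "hist \<in> deviates X k \<inter> set_pmf (run select X m)"
      then have "length hist = m" using length_run by blast
      with h selections_le_length[of hist k]
      show "hist \<in> (\<Union>s\<in>{1..m}. B 1 s \<union> B (- 1) s)"
        by (auto simp: deviates_def B_def a_def abs_if split: if_splits)
    qed
  qed simp
  also have "\<dots> \<le> (\<Sum>s\<in>{1..m}. ?P (B 1 s \<union> B (- 1) s))"
    by (rule measure_pmf.finite_measure_subadditive_finite) auto
  also have "\<dots> \<le> (\<Sum>s\<in>{1..m}. 2 * inverse (real m ^ 4))"
  proof (rule sum_mono)
    fix s assume "s \<in> {1..m}"
    then show "?P (B 1 s \<union> B (- 1) s) \<le> 2 * inverse (real m ^ 4)"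
      using measure_Un_le[of "B 1 s" "run select X m" "B (- 1) s"]
        PB[of s 1] PB[of s "- 1"] by simp
  qed
  also have "\<dots> = 2 * inverse (real m ^ 3)"
    using assms(2) by (simp add: field_simps power_numeral_reduce)
  finally show ?thesis .
qed

text \<open>Since \<open>inverse 0 = 0\<close>, the bound is 0 at \<open>m = 0\<close>; it holds
  because the empty history has no selections and so does not deviate. At \<open>m = 1\<close> the
  bound is 2.\<close>

lemma prob_deviates_le:
  assumes X: "set_pmf (X k) \<subseteq> {c..c + 1}"
  shows "measure_pmf.prob (run select X m) (deviates X k) \<le> 2 * inverse (real m ^ 3)"
proof -
  consider "m = 0" | "m = 1" | "2 \<le> m" by linarith
  then show ?thesis
  proof cases
    case 1
    then show ?thesis by (simp add: deviates_def)
  next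
    case 2
    have "measure_pmf.prob (run select X m) (deviates X k) \<le> 1" by simp
    also have "\<dots> \<le> 2 * inverse (real m ^ 3)" using 2 by simp
    finally show ?thesis .
  next
    case 3
    with X show ?thesis by (rule prob_deviates)
  qed
qed

section \<open>Selections of a suboptimal arm\<close>

text \<open>Without deviations the index of \<open>k\<close> exceeds its mean, and that of
  \<open>j\<close> is below its mean plus twice its width. Choosing \<open>j\<close> then forces the
  gap below twice the width of \<open>j\<close>, which bounds the count of \<open>j\<close>.\<close>

lemma ucb1_choice_deviates:
  assumes hist: "fst ` set hist \<subseteq> {1..n}" "length hist \<le> m"
    and arms: "j \<in> ucb1_choices n hist" "k \<in> {1..n}" "mean (X j) < mean (X k)"
    and many: "8 * ln (real m) / (mean (X k) - mean (X j))\<^sup>2 < real (selections hist j)" "1 \<le> m"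
  shows "hist \<in> deviates X k \<union> deviates X j"
proof (rule ccontr)
  assume nodev: "hist \<notin> deviates X k \<union> deviates X j"
  define N where "N = (\<lambda>i. real (selections hist i))"
  define t where "t = real (length hist)"
  define q where "q = (\<lambda>i. sqrt (2 * ln t / N i))"
  define \<Delta> where "\<Delta> = mean (X k) - mean (X j)"
  \<comment> \<open>An arm that was selected before and is still a choice shows that the initial
    round is over, so all counts are positive and \<open>j\<close> maximises the index.\<close>
  have "0 < N j"
    using many unfolding N_def
    by (smt (verit) divide_nonneg_nonneg ln_ge_zero mult_nonneg_nonneg of_nat_1 of_nat_mono zero_le_power2)
  then have *: "\<forall>i\<in>{1..n}. selections hist i \<noteq> 0"
    and le: "ucb1_index n hist k \<le> ucb1_index n hist j" and "j \<in> {1..n}"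
    using arms(1,2) by (auto simp: ucb1_choices_def N_def split: if_splits)
  have t: "real (\<Sum>i = 1..n. selections hist i) = t"
    using length_eq_sum_selections[OF hist(1)] by (simp add: t_def)
  have pos: "0 < N k"
    using * arms(2) by (simp add: N_def)
  have "1 \<le> t"
    using \<open>0 < N j\<close> selections_le_length[of hist j] by (simp add: t_def N_def)
  have small: "\<bar>deviation X hist i / N i\<bar> < q i" if "i = k \<or> i = j" for i
  proof -
    have Ni: "0 < N i" using that pos \<open>0 < N j\<close> by auto
    have "\<bar>deviation X hist i\<bar> < sqrt (2 * ln t * N i)"
      using nodev that Ni by (auto simp: deviates_def N_def t_def)
    also have "\<dots> = q i * N i"
      using Ni by (simp add: q_def real_sqrt_divide real_sqrt_mult real_div_sqrt field_simps)
    finally show ?thesis using Ni by (simp add: field_simps)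
  qed
  have "mean (X k) + deviation X hist k / N k + q k \<le> mean (X j) + deviation X hist j / N j + q j"
    using le * arms(2) \<open>j \<in> {1..n}\<close>
    by (simp add: ucb1_index_def average_reward_eq[where X = X] q_def N_def flip: t)
  then have "\<Delta> < 2 * q j"
    using small[of k] small[of j] unfolding \<Delta>_def by linarith
  moreover have "0 < \<Delta>" using arms(3) by (simp add: \<Delta>_def)
  ultimately have "\<Delta>\<^sup>2 < (2 * q j)\<^sup>2"
    by (intro power_strict_mono) auto
  also have "\<dots> = 8 * ln t / N j"
    using \<open>1 \<le> t\<close> \<open>0 < N j\<close> by (simp add: q_def power_mult_distrib)
  finally have "N j < 8 * ln t / \<Delta>\<^sup>2"
    using \<open>0 < N j\<close> \<open>0 < \<Delta>\<close> by (simp add: field_simps)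
  also have "\<dots> \<le> 8 * ln (real m) / \<Delta>\<^sup>2"
    using \<open>1 \<le> t\<close> hist(2) by (intro divide_right_mono mult_left_mono ln_mono) (auto simp: t_def)
  finally show False
    using many(1) by (simp add: N_def \<Delta>_def)
qed

text \<open>The cut is at \<open>L + 1\<close> because a selection made while the count is at most
  \<open>L\<close> lifts it to at most \<open>L + 1\<close>. As \<open>L\<close> is computed from
  the final \<open>m\<close>, the potential stays the same throughout the induction on
  \<open>t\<close>.\<close>

lemma nn_integral_truncated_selections:
  assumes rule: "ucb1_rule n select" and k: "k \<in> {1..n}" "mean (X j) < mean (X k)"
    and "1 \<le> m" "t \<le> m"
  defines "L \<equiv> 8 * ln (real m) / (mean (X k) - mean (X j))\<^sup>2"
  shows "(\<integral>\<^sup>+hist. ennreal (max (real (selections hist j)) (L + 1)) \<partial>run select X t) \<le>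
    ennreal (L + 1) + (\<Sum>u<t. emeasure (run select X u) (deviates X k \<union> deviates X j))"
  using \<open>t \<le> m\<close>
proof (induction t)
  case 0
  have "0 \<le> L" using \<open>1 \<le> m\<close> by (simp add: L_def)
  then show ?case by (simp add: max_def)
next
  case (Suc t)
  let ?F = "\<lambda>hist. ennreal (max (real (selections hist j)) (L + 1))"
  let ?B = "deviates X k \<union> deviates X j"
  have "0 \<le> L" using \<open>1 \<le> m\<close> by (simp add: L_def)
  have step: "?F (hist @ [(i, r)]) \<le> ?F hist + indicator ?B hist"
    if hist: "hist \<in> set_pmf (run select X t)" and i: "i \<in> set_pmf (select hist)" for hist i r
  proof (cases "i = j \<and> L < real (selections hist j)")
    case True
    have "j \<in> ucb1_choices n hist"
      using rule i True by (auto simp: ucb1_rule_def)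
    then have "hist \<in> ?B"
      using True Suc.prems length_run[OF hist] \<open>1 \<le> m\<close>
      by (intro ucb1_choice_deviates[OF run_arms[OF rule hist] _ _ k, of m])
        (auto simp: L_def)
    moreover have "?F (hist @ [(i, r)]) \<le> ennreal (max (real (selections hist j)) (L + 1) + 1)"
      by (intro ennreal_leI) (auto simp: max_def)
    ultimately show ?thesis
      using \<open>0 \<le> L\<close> by (simp add: ennreal_plus)
  next
    case False
    then have "?F (hist @ [(i, r)]) \<le> ?F hist"
      by (intro ennreal_leI) auto
    then show ?thesis by (rule order_trans) simp
  qed
  have "(\<integral>\<^sup>+hist. ?F hist \<partial>run select X (Suc t)) =
      (\<integral>\<^sup>+hist. \<integral>\<^sup>+i. \<integral>\<^sup>+r. ?F (hist @ [(i, r)]) \<partial>X i \<partial>select hist \<partial>run select X t)"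
    by (simp del: selections_snoc)
  also have "\<dots> \<le> (\<integral>\<^sup>+hist. \<integral>\<^sup>+i. \<integral>\<^sup>+r. ?F hist + indicator ?B hist \<partial>X i \<partial>select hist \<partial>run select X t)"
    by (intro nn_integral_mono_AE AE_pmfI step) auto
  also have "\<dots> = (\<integral>\<^sup>+hist. ?F hist \<partial>run select X t) + emeasure (run select X t) ?B"
    by (simp add: nn_integral_add)
  also have "\<dots> \<le> ennreal (L + 1) + (\<Sum>u<Suc t. emeasure (run select X u) ?B)"
    using Suc by (simp add: add_right_mono flip: add.assoc)
  finally show ?case .
qed

lemma integrable_selections:
  "integrable (measure_pmf (run select X m)) (\<lambda>hist. real (selections hist j))"
proof (rule measure_pmf.integrable_const_bound[where B = "real m"])
  show "AE hist in run select X m. norm (real (selections hist j)) \<le> real m"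
    using selections_le_length length_run by (fastforce simp: AE_measure_pmf_iff)
qed simp

text \<open>Each of the two arms contributes \<open>2 * inverse (real u ^ 3)\<close> at time
  \<open>u\<close>, hence the factor 4; the term of the series at \<open>u = 0\<close> is 0.\<close>

lemma expected_selections_le:
  assumes rule: "ucb1_rule n select" and X: "\<forall>i\<in>{1..n}. set_pmf (X i) \<subseteq> {c..c + 1}"
    and "j \<in> {1..n}" "k \<in> {1..n}" "mean (X j) < mean (X k)" "1 \<le> m"
  shows "measure_pmf.expectation (run select X m) (\<lambda>hist. real (selections hist j)) \<le>
    8 / (mean (X k) - mean (X j))\<^sup>2 * ln (real m) + (1 + 4 * (\<Sum>u. inverse (real u ^ 3)))"
proof -
  define L where "L = 8 * ln (real m) / (mean (X k) - mean (X j))\<^sup>2"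
  have "0 \<le> L" using assms by (simp add: L_def)
  let ?B = "deviates X k \<union> deviates X j"
  have PB: "measure_pmf.prob (run select X u) ?B \<le> 4 * inverse (real u ^ 3)" for u
    using measure_Un_le[of "deviates X k" "run select X u" "deviates X j"]
      prob_deviates_le[of X k c select u] prob_deviates_le[of X j c select u] X assms(3,4)
    by force
  have "ennreal (measure_pmf.expectation (run select X m) (\<lambda>hist. real (selections hist j))) =
      (\<integral>\<^sup>+hist. ennreal (real (selections hist j)) \<partial>run select X m)"
    by (intro nn_integral_eq_integral[symmetric] integrable_selections) auto
  also have "\<dots> \<le> (\<integral>\<^sup>+hist. ennreal (max (real (selections hist j)) (L + 1)) \<partial>run select X m)"
    by (intro nn_integral_mono ennreal_leI) simp
  also have "\<dots> \<le> ennreal (L + 1) + (\<Sum>u<m. emeasure (run select X u) ?B)"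
    unfolding L_def using assms by (intro nn_integral_truncated_selections) auto
  also have "\<dots> = ennreal (L + 1 + (\<Sum>u<m. measure_pmf.prob (run select X u) ?B))"
    using \<open>0 \<le> L\<close>
    by (simp add: measure_pmf.emeasure_eq_measure sum_ennreal ennreal_plus sum_nonneg)
  finally have "measure_pmf.expectation (run select X m) (\<lambda>hist. real (selections hist j)) \<le>
      L + 1 + (\<Sum>u<m. measure_pmf.prob (run select X u) ?B)"
    using \<open>0 \<le> L\<close> by (subst (asm) ennreal_le_iff) (auto intro!: add_nonneg_nonneg sum_nonneg)
  also have "(\<Sum>u<m. measure_pmf.prob (run select X u) ?B) \<le> (\<Sum>u<m. 4 * inverse (real u ^ 3))"
    by (intro sum_mono PB)
  also have "\<dots> \<le> 4 * (\<Sum>u. inverse (real u ^ 3))"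
    unfolding sum_distrib_left[symmetric]
    by (intro mult_left_mono sum_le_suminf inverse_power_summable) auto
  finally show ?thesis by (simp add: L_def)
qed

section \<open>Regret decomposition and the logarithmic bound\<close>

lemma expected_regret_eq:
  assumes "ucb1_rule n select"
  shows "expected_regret n select X m =
    (\<Sum>j = 1..n. (Max ((\<lambda>j. mean (X j)) ` {1..n}) - mean (X j)) *
       measure_pmf.expectation (run select X m) (\<lambda>hist. real (selections hist j)))"
proof -
  let ?E = "measure_pmf.expectation (run select X m)"
  let ?M = "Max ((\<lambda>j. mean (X j)) ` {1..n})"
  have sums: "?E (\<lambda>hist. \<Sum>(j, r)\<leftarrow>hist. f j) = (\<Sum>j = 1..n. f j * ?E (\<lambda>hist. real (selections hist j)))"
    for f :: "nat \<Rightarrow> real"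
  proof -
    have "?E (\<lambda>hist. \<Sum>(j, r)\<leftarrow>hist. f j) = ?E (\<lambda>hist. \<Sum>j = 1..n. f j * real (selections hist j))"
      using run_arms[OF assms]
      by (intro integral_cong_AE AE_pmfI sum_list_selections) auto
    also have "\<dots> = (\<Sum>j = 1..n. f j * ?E (\<lambda>hist. real (selections hist j)))"
      by (subst Bochner_Integration.integral_sum) (auto intro: integrable_selections)
    finally show ?thesis .
  qed
  \<comment> \<open>Writing the benchmark as a sum over the history lets \<open>sums\<close> apply
    to both terms of the regret.\<close>
  have "?E (\<lambda>hist. \<Sum>(j, r)\<leftarrow>hist. ?M) = ?E (\<lambda>hist. real m * ?M)"
    by (intro integral_cong_AE AE_pmfI)
      (auto simp: case_prod_beta' sum_list_triv dest!: length_run)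
  then have "real m * ?M = ?E (\<lambda>hist. \<Sum>(j, r)\<leftarrow>hist. ?M)"
    by simp
  then show ?thesis
    unfolding expected_regret_def sums by (simp add: left_diff_distrib sum_subtractf)
qed

text \<open>By the decomposition it suffices to bound each of the finitely many arms: optimal arms
  have gap 0, and the others have logarithmic expected counts.\<close>

theorem ucb1_logarithmic_regret:
  assumes "1 \<le> n" and X: "\<forall>j\<in>{1..n}. set_pmf (X j) \<subseteq> {c..c + 1}" and rule: "ucb1_rule n select"
  shows "(\<lambda>m. expected_regret n select X m) \<in> O(\<lambda>m. ln (real m))"
proof -
  define E where "E = (\<lambda>j m. measure_pmf.expectation (run select X m) (\<lambda>hist. real (selections hist j)))"
  have fin: "finite ((\<lambda>j. mean (X j)) ` {1..n})" "(\<lambda>j. mean (X j)) ` {1..n} \<noteq> {}"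
    using \<open>1 \<le> n\<close> by auto
  obtain k where k: "k \<in> {1..n}" "Max ((\<lambda>j. mean (X j)) ` {1..n}) = mean (X k)"
    using Max_in[OF fin] by auto
  have best: "mean (X j) \<le> mean (X k)" if "j \<in> {1..n}" for j
    using Max_ge[OF fin(1) imageI[OF that]] unfolding k(2) .
  have arm: "(\<lambda>m. (mean (X k) - mean (X j)) * E j m) \<in> O(\<lambda>m. ln (real m))" if j: "j \<in> {1..n}" for j
  proof (cases "mean (X j) = mean (X k)")
    case False
    then have less: "mean (X j) < mean (X k)" using best[OF j] by simp
    define C where "C = 1 + 4 * (\<Sum>u. inverse (real u ^ 3))"
    have "(\<Sum>u. inverse (real u ^ 3)) \<ge> 0"
      by (intro suminf_nonneg inverse_power_summable) auto
    then have "0 \<le> C" by (simp add: C_def)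
    have "eventually (\<lambda>m. norm (E j m) \<le>
        (8 / (mean (X k) - mean (X j))\<^sup>2 + C) * norm (ln (real m))) at_top"
      \<comment> \<open>Since 3 > e, here \<open>ln (real m)\<close> is at least 1 and absorbs the
        constant \<open>C\<close>.\<close>
      using eventually_ge_at_top[of 3]
    proof eventually_elim
      case (elim m)
      have "exp 1 \<le> real m"
        using e_less_272 elim by simp
      then have "1 \<le> ln (real m)"
        using elim by (subst ln_ge_iff) auto
      then have "C \<le> C * ln (real m)"
        using \<open>0 \<le> C\<close> mult_left_mono by fastforce
      moreover have "E j m \<le> 8 / (mean (X k) - mean (X j))\<^sup>2 * ln (real m) + C"
        unfolding E_def C_def using rule X j k(1) less elim by (intro expected_selections_le) auto
      moreover have "0 \<le> E j m" by (simp add: E_def)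
      ultimately show ?case
        using \<open>1 \<le> ln (real m)\<close> by (simp add: distrib_right)
    qed
    then have "E j \<in> O(\<lambda>m. ln (real m))" by (rule bigoI)
    then show ?thesis by simp
  qed simp
  have "(\<lambda>m. expected_regret n select X m) = (\<lambda>m. \<Sum>j = 1..n. (mean (X k) - mean (X j)) * E j m)"
    unfolding expected_regret_eq[OF rule] k(2) E_def ..
  then show ?thesis
    by (simp only:) (intro big_sum_in_bigo arm)
qed

text \<open>Every episode draws its reward afresh from a law fixed by the selected policy, so the
  library is a stochastic bandit; the reward range of width 1 is the one matching the UCB1
  width.\<close>

theorem theorem1:
  fixes \<Omega> :: "('s, 'a) task"
    and n :: nat
    and \<pi> :: "nat \<Rightarrow> 's \<Rightarrow> 'a"
    and \<psi> :: "nat \<Rightarrow> real"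
    and \<rho> :: "'s \<Rightarrow> 'a pmf"
    and c :: real
    and select :: "history \<Rightarrow> nat pmf"
  assumes "wf_task \<Omega>"
    and "n \<ge> 1"
    and "\<forall>j\<in>{1..n}. source_policy \<Omega> (\<pi> j)"
    and "\<forall>h\<in>{1..horizon \<Omega>}. 0 \<le> \<psi> h \<and> \<psi> h \<le> 1"
    and "\<forall>j\<in>{1..n}. set_pmf (reuse_reward \<Omega> \<psi> \<rho> (\<pi> j)) \<subseteq> {c..c + 1}"
    and "ucb1_rule n select"
  shows "(\<lambda>m. expected_regret n select (\<lambda>j. reuse_reward \<Omega> \<psi> \<rho> (\<pi> j)) m)
           \<in> O(\<lambda>m. ln (real m))"
  using assms(2,5,6) by (rule ucb1_logarithmic_regret)

end
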